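(* Let $\mathfrak I\sim\mathcal I(n,D,p)$. (a) Let $D$ be a fixed positive integer and $d$ a constant integer with $1<d\le D$. If $p=p(n)\in[0,1]$ satisfies $p(n)=\omega(n^{-d})$ and $p(n)=o(n^{-d+1})$ as $n\to\infty$, then $\mathrm{initdeg}(\mathfrak I)=d$ asymptotically almost surely (as $n\to\infty$). (b) Let $n\ge1$ be fixed. Let $d_1=d_1(D)$ and $d_2=d_2(D)$ be integer-valued functions with $1\le d_i(D)\le D$ and $\lim_{D\to\infty}d_i(D)=\infty$ for $i\in\{1,2\}$. If $p=p(D)\in[0,1]$ satisfies $p(D)=\omega(d_1^{-n})$ and $p(D)=o(d_2^{-n})$ as $D\to\infty$, then $d_2\le\mathrm{initdeg}(\mathfrak I)\le d_1$ asymptotically almost surely (as $D\to\infty$). Moreover, such a function $p$ exists when $d_1(D)=\omega(d_2(D))$.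
   Context: Let $k$ be a field and $S=k[x_1,\dots,x_n]$. $\mathcal B(n,D,p)$ is the distribution of the random set $\mathfrak B$ of monomials of $S$ obtained by including each non-constant monomial of total degree at most $D$ independently with probability $p$. $\mathcal I(n,D,p)$ is the distribution of the random monomial ideal $\mathfrak I=(\mathfrak B)$, with $\mathfrak I=(0)$ if $\mathfrak B=\emptyset$. For a monomial ideal $I$, $\mathrm{initdeg}(I)$ is the smallest degree of a minimal generator of $I$ (the smallest $k$ with $\beta_{1,k}(S/I)\ne0$), with $\mathrm{initdeg}((0))=+\infty$. $f=o(g)$, equivalently $g=\omega(f)$, means $\lim f/g=0$. An event holds asymptotically almost surely if its probability tends to $1$. *)

theory Defs
  imports
    "HOL-Library.Poly_Mapping"
    "HOL-Library.Extended_Nat"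
    "HOL-Library.Landau_Symbols"
    "HOL-Algebra.Ideal"
    "HOL-Probability.Probability"
    "HOL-Probability.Product_PMF"
begin

text \<open>
  Polynomials are finitely supported coefficient functions on exponent vectors, with one
  indeterminate for every natural number; the ring in the \<open>n\<close> variables
  \<open>x\<^sub>1, \<dots>, x\<^sub>n\<close> is the subring using only the indices \<open>0, \<dots>, n - 1\<close>, since \<open>n\<close> has
  to vary. Monomials are identified with their exponent vectors, and \<open>mon a\<close> is the
  monomial \<open>a\<close> as an element of the polynomial ring.
\<close>

type_synonym expo = "nat \<Rightarrow>\<^sub>0 nat"
type_synonym 'k mpoly = "expo \<Rightarrow>\<^sub>0 'k"

definition monomials :: "nat \<Rightarrow> expo set" where
  "monomials n = {a. Poly_Mapping.keys a \<subseteq> {..<n}}"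

definition mdeg :: "expo \<Rightarrow> nat" where
  "mdeg a = (\<Sum>i\<in>Poly_Mapping.keys a. Poly_Mapping.lookup a i)"

definition mon :: "expo \<Rightarrow> 'k::field mpoly" where
  "mon a = Poly_Mapping.single a 1"

definition poly_ring :: "nat \<Rightarrow> 'k::field mpoly ring" where
  "poly_ring n = \<lparr>carrier = {f. Poly_Mapping.keys f \<subseteq> monomials n},
     monoid.mult = (*), one = 1, zero = 0, add = (+)\<rparr>"

definition monomial_ideal :: "nat \<Rightarrow> expo set \<Rightarrow> 'k::field mpoly set" where
  "monomial_ideal n B = Idl\<^bsub>poly_ring n\<^esub> (mon ` B)"

definition nonconst_monomials :: "nat \<Rightarrow> nat \<Rightarrow> expo set" where
  "nonconst_monomials n D = {a \<in> monomials n. 1 \<le> mdeg a \<and> mdeg a \<le> D}"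

text \<open>
  The distribution \<open>\<B>(n,D,p)\<close>: one independent Bernoulli trial per admissible monomial. The
  finiteness of the index set, on which \<open>Pi_pmf\<close> relies, is proved below.
\<close>

definition random_monomials :: "nat \<Rightarrow> nat \<Rightarrow> real \<Rightarrow> expo set pmf" where
  "random_monomials n D p =
     map_pmf (\<lambda>f. {a \<in> nonconst_monomials n D. f a})
       (Pi_pmf (nonconst_monomials n D) False (\<lambda>_. bernoulli_pmf p))"

definition random_ideal :: "nat \<Rightarrow> nat \<Rightarrow> real \<Rightarrow> 'k::field mpoly set pmf" where
  "random_ideal n D p = map_pmf (monomial_ideal n) (random_monomials n D p)"

definition minimal_generating_set :: "nat \<Rightarrow> 'k::field mpoly set \<Rightarrow> expo set \<Rightarrow> bool" where
  "minimal_generating_set n I G \<longleftrightarrow>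
     G \<subseteq> monomials n \<and> monomial_ideal n G = I \<and> (\<forall>H. H \<subset> G \<longrightarrow> monomial_ideal n H \<noteq> I)"

text \<open>
  A monomial ideal has exactly one minimal generating set of monomials, so the union below is
  that set. The infimum over the empty set in \<^typ>\<open>enat\<close> is \<open>\<infinity>\<close>, the value for the zero ideal.
\<close>

definition initdeg :: "nat \<Rightarrow> 'k::field mpoly set \<Rightarrow> enat" where
  "initdeg n I = (INF a\<in>\<Union>{G. minimal_generating_set n I G}. enat (mdeg a))"

lemma zero_in_monomials: "0 \<in> monomials n"
  by (simp add: monomials_def)

lemma add_in_monomials: "a \<in> monomials n \<Longrightarrow> b \<in> monomials n \<Longrightarrow> a + b \<in> monomials n"
  using Poly_Mapping.keys_add[of a b] by (auto simp: monomials_def)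

lemma cring_poly_ring: "cring (poly_ring n :: 'k::field mpoly ring)"
proof (rule cringI)
  show "abelian_group (poly_ring n :: 'k mpoly ring)"
  proof (rule abelian_groupI)
    fix f :: "'k mpoly" assume "f \<in> carrier (poly_ring n)"
    then show "\<exists>g\<in>carrier (poly_ring n). g \<oplus>\<^bsub>poly_ring n\<^esub> f = \<zero>\<^bsub>poly_ring n\<^esub>"
      by (intro bexI[of _ "- f"]) (auto simp: poly_ring_def)
  next
    fix f g :: "'k mpoly" assume "f \<in> carrier (poly_ring n)" "g \<in> carrier (poly_ring n)"
    then show "f \<oplus>\<^bsub>poly_ring n\<^esub> g \<in> carrier (poly_ring n)"
      using Poly_Mapping.keys_add[of f g] by (auto simp: poly_ring_def)
  qed (auto simp: poly_ring_def algebra_simps)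
  show "comm_monoid (poly_ring n :: 'k mpoly ring)"
  proof (rule comm_monoidI)
    fix f g :: "'k mpoly" assume "f \<in> carrier (poly_ring n)" "g \<in> carrier (poly_ring n)"
    then show "f \<otimes>\<^bsub>poly_ring n\<^esub> g \<in> carrier (poly_ring n)"
      using Poly_Mapping.keys_mult[of f g] add_in_monomials by (fastforce simp: poly_ring_def)
  qed (auto simp: poly_ring_def algebra_simps zero_in_monomials)
qed (auto simp: poly_ring_def algebra_simps)

lemma mon_in_carrier: "mon ` B \<subseteq> carrier (poly_ring n) \<longleftrightarrow> B \<subseteq> monomials n"
  by (auto simp: mon_def poly_ring_def)

lemma finite_nonconst_monomials: "finite (nonconst_monomials n D)"
proof -
  have "Poly_Mapping.lookup ` nonconst_monomials n D
      \<subseteq> {f. \<forall>i. (i \<in> {..<n} \<longrightarrow> f i \<in> {..D}) \<and> (i \<notin> {..<n} \<longrightarrow> f i = 0)}"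
  proof (clarsimp simp: nonconst_monomials_def monomials_def mdeg_def, intro conjI impI)
    fix a :: expo and i
    assume a: "Poly_Mapping.keys a \<subseteq> {..<n}"
      "sum (Poly_Mapping.lookup a) (Poly_Mapping.keys a) \<le> D"
    show "Poly_Mapping.lookup a i \<le> D"
    proof (cases "i \<in> Poly_Mapping.keys a")
      case True
      then show ?thesis
        using member_le_sum[of i "Poly_Mapping.keys a" "Poly_Mapping.lookup a"] a(2) by simp
    qed (simp add: in_keys_iff)
    show "Poly_Mapping.lookup a i = 0" if "\<not> i < n"
      using a(1) that by (metis in_keys_iff lessThan_iff subsetD)
  qed
  moreover have "finite {f. \<forall>i. (i \<in> {..<n} \<longrightarrow> f i \<in> {..D}) \<and> (i \<notin> {..<n} \<longrightarrow> f i = 0)}"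
    by (rule finite_set_of_finite_funs) auto
  ultimately show ?thesis
    by (meson finite_imageD finite_subset inj_onI Poly_Mapping.lookup_inject)
qed

lemma monomial_ideal_empty: "monomial_ideal n {} = ({0} :: 'k::field mpoly set)"
proof -
  interpret cring "poly_ring n :: 'k mpoly ring" by (rule cring_poly_ring)
  have "Idl\<^bsub>poly_ring n\<^esub> {} \<subseteq> {\<zero>\<^bsub>poly_ring n\<^esub> :: 'k mpoly}"
    by (rule genideal_minimal[OF zeroideal]) simp
  moreover have "\<zero>\<^bsub>poly_ring n\<^esub> \<in> Idl\<^bsub>poly_ring n\<^esub> ({} :: 'k mpoly set)"
    by (rule additive_subgroup.zero_closed[OF ideal.axioms(1)[OF genideal_ideal]]) simp
  ultimately show ?thesis
    by (auto simp: monomial_ideal_def poly_ring_def)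
qed

lemma initdeg_zero_ideal: "initdeg n ({0} :: 'k::field mpoly set) = \<infinity>"
proof -
  have "G = {}" if "minimal_generating_set n ({0} :: 'k mpoly set) G" for G
    using that monomial_ideal_empty[of n, where 'k = 'k] 
    unfolding minimal_generating_set_def by (metis empty_subsetI psubsetI)
  then have "\<Union>{G. minimal_generating_set n ({0} :: 'k mpoly set) G} = {}"
    by blast
  then show ?thesis
    by (simp add: initdeg_def top_enat_def del: Sup_bot_conv)
qed

end

theory Submission
  imports Defs
begin

text \<open>
  The initial degree of the ideal generated by a finite set \<open>B\<close> of monomials is the least degree
  that occurs in \<open>B\<close> (\<open>initdeg_monomial_ideal\<close>): multiplication cannot lower degrees, so every
  monomial of the ideal is at least as large in degree as some element of \<open>B\<close>. Hence the event
  \<open>initdeg > k\<close> says that none of the \<open>N(n,k)\<close> non-constant monomials of degree at most \<open>k\<close> was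
  chosen, and for \<open>k \<le> D\<close> it has probability exactly \<open>(1 - p)\<^bsup>N(n,k)\<^esup>\<close>.

  Since \<open>1 - p N \<le> (1 - p)\<^bsup>N\<^esup> \<le> exp (- p N)\<close>, both parts follow from one first-moment principle
  (\<open>initdeg_between_asymptotically_almost_surely\<close>): if the expected number \<open>p N(n, lo - 1)\<close> of
  chosen monomials of degree below \<open>lo\<close> tends to \<open>0\<close> and the expected number \<open>p N(n, hi)\<close> of those
  of degree at most \<open>hi\<close> tends to infinity, then \<open>lo \<le> initdeg \<le> hi\<close> asymptotically almost surely.
  The two regimes differ only in which side of the symmetric formula
  \<open>N(n,k) + 1 = (n + k) choose k = (n + k) choose n\<close> is used: for a fixed degree \<open>k \<ge> 1\<close> it makes \<open>N(n,k)\<close>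
  of order \<open>n\<^sup>k\<close>, for a fixed number \<open>n\<close> of variables of order \<open>k\<^sup>n\<close>.

  A function \<open>p\<close> strictly between \<open>d\<^sub>1\<^bsup>-n\<^esup>\<close> and \<open>d\<^sub>2\<^bsup>-n\<^esup>\<close> in growth is their geometric mean
  (\<open>geometric_mean_between\<close>).
\<close>

section \<open>The initial degree of a generated ideal\<close>

lemma mdeg_eq_sum:
  assumes "finite A" "Poly_Mapping.keys a \<subseteq> A"
  shows "mdeg a = (\<Sum>i\<in>A. Poly_Mapping.lookup a i)"
  unfolding mdeg_def
  by (rule sum.mono_neutral_left) (use assms in \<open>auto simp: in_keys_iff\<close>)

lemma mdeg_add: "mdeg (a + b) = mdeg a + mdeg b"
proof -
  let ?A = "Poly_Mapping.keys a \<union> Poly_Mapping.keys b"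
  have "mdeg (a + b) = (\<Sum>i\<in>?A. Poly_Mapping.lookup (a + b) i)"
    using Poly_Mapping.keys_add[of a b] by (intro mdeg_eq_sum) auto
  moreover have "mdeg a = (\<Sum>i\<in>?A. Poly_Mapping.lookup a i)"
    and "mdeg b = (\<Sum>i\<in>?A. Poly_Mapping.lookup b i)"
    by (rule mdeg_eq_sum; simp)+
  ultimately show ?thesis
    by (simp add: lookup_add sum.distrib)
qed

text \<open>
  The polynomials without terms of degree below \<open>k\<close> form an ideal. Comparing an ideal generated in
  degrees at least \<open>k\<close> with this one bounds the degrees of its monomials from below without any
  description of its elements as linear combinations of generators.
\<close>

lemma ideal_order_ge:
  "ideal {f :: 'k::field mpoly. Poly_Mapping.keys f \<subseteq> {a \<in> monomials n. k \<le> mdeg a}} (poly_ring n)"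
  (is "ideal ?J _")
proof -
  interpret cring "poly_ring n :: 'k mpoly ring" by (rule cring_poly_ring)
  have mult: "g * f \<in> ?J" if "f \<in> ?J" "g \<in> carrier (poly_ring n)" for f g :: "'k mpoly"
  proof -
    have "c \<in> {a \<in> monomials n. k \<le> mdeg a}" if c: "c \<in> Poly_Mapping.keys (g * f)" for c
    proof -
      obtain a b where "c = a + b" "a \<in> Poly_Mapping.keys g" "b \<in> Poly_Mapping.keys f"
        using c Poly_Mapping.keys_mult[of g f] by blast
      then show ?thesis
        using \<open>f \<in> ?J\<close> \<open>g \<in> carrier (poly_ring n)\<close> add_in_monomials
        by (fastforce simp: poly_ring_def mdeg_add)
    qed
    then show ?thesis by blast
  qed
  show ?thesis
  proof (rule idealI[OF ring_axioms])
    show "subgroup ?J (add_monoid (poly_ring n))"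
    proof (rule group.subgroupI[OF a_group])
      show "?J \<subseteq> carrier (add_monoid (poly_ring n))"
        by (auto simp: poly_ring_def)
      show "?J \<noteq> {}"
        by (auto intro: exI[of _ 0])
    next
      fix f :: "'k mpoly" assume f: "f \<in> ?J"
      have "\<ominus>\<^bsub>poly_ring n\<^esub> f = - f"
        by (rule minus_equality) (use f in \<open>auto simp: poly_ring_def\<close>)
      then show "inv\<^bsub>add_monoid (poly_ring n)\<^esub> f \<in> ?J"
        using f by (simp add: a_inv_def)
    next
      fix f g :: "'k mpoly" assume "f \<in> ?J" "g \<in> ?J"
      then show "f \<otimes>\<^bsub>add_monoid (poly_ring n)\<^esub> g \<in> ?J"
        using Poly_Mapping.keys_add[of f g] by (auto simp: poly_ring_def)
    qed
  next
    fix f g :: "'k mpoly" assume fg: "f \<in> ?J" "g \<in> carrier (poly_ring n)"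
    show "g \<otimes>\<^bsub>poly_ring n\<^esub> f \<in> ?J"
      using mult[OF fg] by (simp add: poly_ring_def)
    show "f \<otimes>\<^bsub>poly_ring n\<^esub> g \<in> ?J"
      using mult[OF fg] by (simp add: poly_ring_def mult.commute)
  qed
qed

text \<open>
  If all of \<open>B\<close> had degree above that of \<open>a\<close>, the ideal of polynomials of order at least
  \<open>mdeg a + 1\<close> would contain \<open>B\<close> but not \<open>a\<close>.
\<close>

lemma mon_in_monomial_ideal_mdeg_ge:
  assumes "B \<subseteq> monomials n" "mon a \<in> (monomial_ideal n B :: 'k::field mpoly set)"
  shows "\<exists>b\<in>B. mdeg b \<le> mdeg a"
proof (rule ccontr)
  assume "\<not> (\<exists>b\<in>B. mdeg b \<le> mdeg a)"
  then have "(mon ` B :: 'k mpoly set)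
      \<subseteq> {f. Poly_Mapping.keys f \<subseteq> {c \<in> monomials n. Suc (mdeg a) \<le> mdeg c}}"
    using assms(1) by (force simp: mon_def)
  then have "(monomial_ideal n B :: 'k mpoly set)
      \<subseteq> {f. Poly_Mapping.keys f \<subseteq> {c \<in> monomials n. Suc (mdeg a) \<le> mdeg c}}"
    unfolding monomial_ideal_def
    by (intro ring.genideal_minimal[OF cring.axioms(1)[OF cring_poly_ring] ideal_order_ge])
  then show False
    using assms(2) by (auto simp: mon_def)
qed

lemma mon_in_monomial_ideal:
  assumes "B \<subseteq> monomials n" "b \<in> B"
  shows "mon b \<in> (monomial_ideal n B :: 'k::field mpoly set)"
  using ring.genideal_self[OF cring.axioms(1)[OF cring_poly_ring], of "mon ` B :: 'k mpoly set" n]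
    assms mon_in_carrier[of B n, where 'a = 'k]
  by (auto simp: monomial_ideal_def)

lemma ex_minimal_generating_subset:
  assumes "finite B" "B \<subseteq> monomials n"
  shows "\<exists>G\<subseteq>B. minimal_generating_set n (monomial_ideal n B :: 'k::field mpoly set) G"
proof -
  let ?gen = "\<lambda>G. G \<subseteq> B \<and> (monomial_ideal n G :: 'k mpoly set) = monomial_ideal n B"
  have "finite {G. ?gen G}"
    by (rule finite_subset[of _ "Pow B"]) (use assms(1) in auto)
  moreover have "{G. ?gen G} \<noteq> {}"
    by blast
  ultimately obtain G where "G \<in> {G. ?gen G}" and min: "\<forall>H\<in>{G. ?gen G}. H \<subseteq> G \<longrightarrow> G = H"
    using finite_has_minimal[of "{G. ?gen G}"] by auto
  then have G: "?gen G" by simp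
  have "minimal_generating_set n (monomial_ideal n B :: 'k mpoly set) G"
    unfolding minimal_generating_set_def
  proof (intro conjI allI impI)
    fix H assume "H \<subset> G"
    then show "monomial_ideal n H \<noteq> (monomial_ideal n B :: 'k mpoly set)"
      using G min by auto
  qed (use G assms(2) in auto)
  then show ?thesis using G by blast
qed

text \<open>
  The initial degree refers to minimal generating sets, of which \<open>B\<close> need not be one. The degree
  comparison is applied twice: to a minimal generating set \<open>G\<close> inside \<open>B\<close>, where it shows that passing
  from \<open>B\<close> to \<open>G\<close> loses no low degree, and to \<open>B\<close> itself, where it shows that no other minimal
  generating set reaches a lower degree.
\<close>

lemma initdeg_monomial_ideal:
  assumes "finite B" "B \<subseteq> monomials n"
  shows "initdeg n (monomial_ideal n B :: 'k::field mpoly set) = (INF b\<in>B. enat (mdeg b))"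
proof (rule antisym)
  let ?I = "monomial_ideal n B :: 'k mpoly set"
  show "initdeg n ?I \<le> (INF b\<in>B. enat (mdeg b))"
  proof (rule INF_greatest)
    fix b assume b: "b \<in> B"
    obtain G where G: "G \<subseteq> B" "minimal_generating_set n ?I G"
      using ex_minimal_generating_subset[OF assms] by blast
    have "mon b \<in> (monomial_ideal n G :: 'k mpoly set)"
      using mon_in_monomial_ideal[OF assms(2) b] G(2) by (simp add: minimal_generating_set_def)
    then obtain g where g: "g \<in> G" "mdeg g \<le> mdeg b"
      using mon_in_monomial_ideal_mdeg_ge G assms(2) by blast
    show "initdeg n ?I \<le> enat (mdeg b)"
      unfolding initdeg_def by (rule INF_lower2[of g]) (use g G in auto)
  qed
  show "(INF b\<in>B. enat (mdeg b)) \<le> initdeg n ?I"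
    unfolding initdeg_def
  proof (rule INF_greatest)
    fix a assume "a \<in> \<Union>{G. minimal_generating_set n ?I G}"
    then obtain G where "a \<in> G" "G \<subseteq> monomials n" "monomial_ideal n G = ?I"
      by (auto simp: minimal_generating_set_def)
    then have "mon a \<in> ?I"
      using mon_in_monomial_ideal by metis
    then obtain b where "b \<in> B" "mdeg b \<le> mdeg a"
      using mon_in_monomial_ideal_mdeg_ge assms(2) by blast
    then show "(INF b\<in>B. enat (mdeg b)) \<le> enat (mdeg a)"
      by (intro INF_lower2[of b]) auto
  qed
qed

lemma initdeg_monomial_ideal_le_iff:
  assumes "finite B" "B \<subseteq> monomials n"
  shows "initdeg n (monomial_ideal n B :: 'k::field mpoly set) \<le> enat k
           \<longleftrightarrow> (\<exists>b\<in>B. mdeg b \<le> k)"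
proof
  assume le: "initdeg n (monomial_ideal n B :: 'k mpoly set) \<le> enat k"
  show "\<exists>b\<in>B. mdeg b \<le> k"
  proof (rule ccontr)
    assume "\<not> (\<exists>b\<in>B. mdeg b \<le> k)"
    then have "enat (Suc k) \<le> (INF b\<in>B. enat (mdeg b))"
      by (intro INF_greatest) (auto simp: not_le)
    also have "\<dots> \<le> enat k"
      using le by (simp add: initdeg_monomial_ideal[OF assms])
    finally show False by simp
  qed
next
  assume "\<exists>b\<in>B. mdeg b \<le> k"
  then show "initdeg n (monomial_ideal n B :: 'k mpoly set) \<le> enat k"
    unfolding initdeg_monomial_ideal[OF assms] by (auto intro: INF_lower2)
qed

section \<open>Counting monomials of bounded degree\<close>

lemma mdeg_monomial:
  assumes "a \<in> monomials n"
  shows "mdeg a = (\<Sum>i<n. Poly_Mapping.lookup a i)"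
  using assms by (intro mdeg_eq_sum) (auto simp: monomials_def)

text \<open>
  Stars and bars: recording the defect \<open>k - mdeg a\<close> in one additional coordinate turns exponent
  vectors of degree at most \<open>k\<close> into lists of \<open>n + 1\<close> numbers with sum exactly \<open>k\<close>.
\<close>

lemma card_monomials_mdeg_le: "card {a \<in> monomials n. mdeg a \<le> k} = (n + k) choose k"
proof -
  let ?L = "{l :: nat list. length l = Suc n \<and> sum_list l = k}"
  let ?f = "\<lambda>a. (k - mdeg a) # map (Poly_Mapping.lookup a) [0..<n]"
  have "bij_betw ?f {a \<in> monomials n. mdeg a \<le> k} ?L"
  proof (rule bij_betw_byWitness[where f' = "\<lambda>l. Poly_Mapping.nth (tl l)"])
    show "\<forall>a\<in>{a \<in> monomials n. mdeg a \<le> k}. Poly_Mapping.nth (tl (?f a)) = a"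
      by (auto intro!: poly_mapping_eqI simp: nth_default_def monomials_def in_keys_iff)
    have nth: "Poly_Mapping.nth l \<in> monomials n \<and> mdeg (Poly_Mapping.nth l) = sum_list l"
      if "length l = n" for l :: "nat list"
    proof -
      have "Poly_Mapping.nth l \<in> monomials n"
        using that by (auto simp: monomials_def in_keys_iff nth_default_def
          simp del: keys_nth split: if_splits)
      then show ?thesis
        using that by (simp add: mdeg_monomial sum_list_sum_nth nth_default_def atLeast0LessThan)
    qed
    show "(\<lambda>l. Poly_Mapping.nth (tl l)) ` ?L \<subseteq> {a \<in> monomials n. mdeg a \<le> k}"
      using nth by (auto simp: length_Suc_conv)
    show "\<forall>l\<in>?L. ?f (Poly_Mapping.nth (tl l)) = l"
    proof
      fix l assume "l \<in> ?L"
      then obtain x xs where l: "l = x # xs" "length xs = n" "x + sum_list xs = k"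
        by (cases l) auto
      have "map (Poly_Mapping.lookup (Poly_Mapping.nth xs)) [0..<n] = xs"
        using l(2) by (intro nth_equalityI) (simp_all add: nth_default_def)
      then show "?f (Poly_Mapping.nth (tl l)) = l"
        using nth[OF l(2)] l by auto
    qed
    show "?f ` {a \<in> monomials n. mdeg a \<le> k} \<subseteq> ?L"
      by (auto simp: mdeg_monomial interv_sum_list_conv_sum_set_nat atLeast0LessThan)
  qed
  then have "card {a \<in> monomials n. mdeg a \<le> k} = card ?L"
    by (rule bij_betw_same_card)
  then show ?thesis
    by (simp add: card_length_sum_list add.commute)
qed

lemma card_nonconst_monomials: "card (nonconst_monomials n k) + 1 = (n + k) choose k"
proof -
  have "a = 0" if "mdeg a = 0" for a
    using that by (auto simp: mdeg_def in_keys_iff intro: poly_mapping_eqI)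
  then have "{a \<in> monomials n. mdeg a \<le> k} = insert 0 (nonconst_monomials n k)"
    by (auto simp: nonconst_monomials_def zero_in_monomials mdeg_def[of 0] Suc_le_eq)
  moreover have "0 \<notin> nonconst_monomials n k"
    by (simp add: nonconst_monomials_def mdeg_def)
  ultimately show ?thesis
    using card_monomials_mdeg_le[of n k] by (simp add: finite_nonconst_monomials)
qed

lemma one_plus_power_ge:
  fixes x :: real
  assumes "0 \<le> x" "0 < k"
  shows "1 + x ^ k \<le> (1 + x) ^ k"
proof -
  have "1 + x ^ Suc j \<le> (1 + x) ^ Suc j" for j
  proof (induction j)
    case (Suc j)
    have "1 + x ^ Suc (Suc j) \<le> (1 + x) * (1 + x ^ Suc j)"
      using assms(1) by (simp add: algebra_simps)
    also have "\<dots> \<le> (1 + x) * (1 + x) ^ Suc j"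
      using Suc assms(1) by (intro mult_left_mono) auto
    finally show ?case by simp
  qed simp
  then show ?thesis
    using assms(2) by (metis Suc_pred)
qed

text \<open>
  The general estimate \<open>(m / k)\<^sup>k \<le> m choose k\<close> with \<open>m = n + k\<close>, weakened to a form that is a pure
  power of \<open>n / k\<close> once \<open>1\<close> is subtracted.
\<close>

lemma choose_sum_ge:
  assumes "0 < k"
  shows "1 + (real n / real k) ^ k \<le> real ((n + k) choose k)"
proof -
  have "1 + (real n / real k) ^ k \<le> (1 + real n / real k) ^ k"
    using assms by (intro one_plus_power_ge) auto
  also have "\<dots> = (real (n + k) / real k) ^ k"
    using assms by (simp add: field_simps)
  also have "\<dots> \<le> real ((n + k) choose k)"
    by (rule binomial_ge_n_over_k_pow_k) simp
  finally show ?thesis .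
qed

text \<open>
  The two bounds come from the two sides of the symmetry of the binomial coefficient. The summand
  \<open>1\<close> in \<open>choose_sum_ge\<close> pays for the excluded constant monomial.
\<close>

lemma card_nonconst_monomials_ge:
  assumes "0 < n" "0 < k"
  shows "(real n / real k) ^ k \<le> real (card (nonconst_monomials n k))"
    and "(real k / real n) ^ n \<le> real (card (nonconst_monomials n k))"
proof -
  have "real (card (nonconst_monomials n k)) + 1 = real ((n + k) choose k)"
    using card_nonconst_monomials[of n k] by linarith
  moreover have "(n + k) choose k = (k + n) choose n"
    using binomial_symmetric[of k "n + k"] by (simp add: add.commute)
  ultimately show "(real n / real k) ^ k \<le> real (card (nonconst_monomials n k))"
    and "(real k / real n) ^ n \<le> real (card (nonconst_monomials n k))"
    using choose_sum_ge[OF assms(2), of n] choose_sum_ge[OF assms(1), of k] by linarith+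
qed

text \<open>
  Degrees strictly below \<open>k\<close> are counted, because it is this number that has to be negligible when
  \<open>k\<close> is a lower bound for the initial degree. Crude bounds are enough: the constants \<open>k\<^bsup>k-1\<^esup>\<close> and
  \<open>n\<^sup>n\<close> that they contribute are fixed in the regime where the bound is used.
\<close>

lemma card_nonconst_monomials_le:
  assumes "0 < n" "0 < k"
  shows "card (nonconst_monomials n (k - 1)) \<le> (n * k) ^ (k - 1)"
    and "card (nonconst_monomials n (k - 1)) \<le> (n * k) ^ n"
proof -
  have le: "n + (k - 1) \<le> n * k"
    using assms by (cases n; cases k) auto
  have "(n + (k - 1)) choose (k - 1) \<le> (n * k) ^ (k - 1)"
    by (rule order_trans[OF binomial_le_pow power_mono]) (use le in auto)
  moreover have "(n + (k - 1)) choose n \<le> (n * k) ^ n"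
    by (rule order_trans[OF binomial_le_pow power_mono]) (use le in auto)
  moreover have "(n + (k - 1)) choose (k - 1) = (n + (k - 1)) choose n"
    using binomial_symmetric[of n "n + (k - 1)"] by simp
  ultimately show "card (nonconst_monomials n (k - 1)) \<le> (n * k) ^ (k - 1)"
    and "card (nonconst_monomials n (k - 1)) \<le> (n * k) ^ n"
    using card_nonconst_monomials[of n "k - 1"] by linarith+
qed

section \<open>The tails of the random initial degree\<close>

lemma prob_random_monomials_disjoint:
  assumes "0 \<le> p" "p \<le> 1" "A \<subseteq> nonconst_monomials n D"
  shows "measure_pmf.prob (random_monomials n D p) {B. B \<inter> A = {}} = (1 - p) ^ card A"
proof -
  let ?N = "nonconst_monomials n D"
  let ?M = "Pi_pmf ?N False (\<lambda>_. bernoulli_pmf p)"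
  have "measure_pmf.prob (random_monomials n D p) {B. B \<inter> A = {}}
      = measure_pmf.prob ?M (Pi ?N (\<lambda>a. if a \<in> A then {False} else UNIV))"
    unfolding random_monomials_def measure_map_pmf
    by (rule arg_cong[where f = "measure_pmf.prob ?M"]) (use assms(3) in \<open>auto simp: Pi_def\<close>)
  also have "\<dots> = (\<Prod>a\<in>?N. measure_pmf.prob (bernoulli_pmf p) (if a \<in> A then {False} else UNIV))"
    by (rule measure_Pi_pmf_Pi) (rule finite_nonconst_monomials)
  also have "\<dots> = (\<Prod>a\<in>?N. if a \<in> A then 1 - p else 1)"
    using assms(1,2) by (intro prod.cong) (auto simp: measure_pmf_single)
  also have "\<dots> = (\<Prod>a\<in>A. 1 - p)"
    using assms(3) by (intro prod.mono_neutral_cong_right) (auto simp: finite_nonconst_monomials)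
  finally show ?thesis by simp
qed

text \<open>
  On the support of the distribution, the initial degree exceeds \<open>k\<close> exactly if no non-constant
  monomial of degree at most \<open>k\<close> was chosen. All of these take part in the trials since \<open>k \<le> D\<close>.
\<close>

lemma prob_random_ideal_initdeg_gt:
  assumes "0 \<le> p" "p \<le> 1" "k \<le> D"
  shows "measure_pmf.prob (random_ideal n D p) {I :: 'k::field mpoly set. \<not> initdeg n I \<le> enat k}
           = (1 - p) ^ card (nonconst_monomials n k)"
proof -
  have "measure_pmf.prob (random_ideal n D p) {I :: 'k mpoly set. \<not> initdeg n I \<le> enat k}
      = measure_pmf.prob (random_monomials n D p) {B. B \<inter> nonconst_monomials n k = {}}"
    unfolding random_ideal_def measure_map_pmf
  proof (rule measure_pmf.finite_measure_eq_AE)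
    have "B \<in> monomial_ideal n -` {I :: 'k mpoly set. \<not> initdeg n I \<le> enat k}
        \<longleftrightarrow> B \<in> {B. B \<inter> nonconst_monomials n k = {}}"
      if "B \<in> set_pmf (random_monomials n D p)" for B
    proof -
      have B: "B \<subseteq> nonconst_monomials n D"
        using that by (auto simp: random_monomials_def)
      then have "finite B"
        using finite_nonconst_monomials finite_subset by blast
      moreover have "B \<subseteq> monomials n"
        using B by (auto simp: nonconst_monomials_def)
      ultimately show ?thesis
        using B initdeg_monomial_ideal_le_iff[of B n k, where 'k = 'k]
        by (auto simp: nonconst_monomials_def)
    qed
    then show "AE B in measure_pmf (random_monomials n D p).
        (B \<in> monomial_ideal n -` {I :: 'k mpoly set. \<not> initdeg n I \<le> enat k})
        = (B \<in> {B. B \<inter> nonconst_monomials n k = {}})"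
      by (intro AE_pmfI)
  qed simp_all
  also have "\<dots> = (1 - p) ^ card (nonconst_monomials n k)"
    using assms by (intro prob_random_monomials_disjoint) (auto simp: nonconst_monomials_def)
  finally show ?thesis .
qed

text \<open>
  The event is \<open>initdeg > lo - 1\<close> without \<open>initdeg > hi\<close>. Bernoulli's inequality bounds the
  probability of the former from below, and \<open>1 - p \<le> exp (- p)\<close> that of the latter from above.
\<close>

lemma prob_initdeg_between_ge:
  fixes p :: real
  assumes p: "0 \<le> p" "p \<le> 1" and lo: "1 \<le> lo" "lo \<le> D" and hi: "hi \<le> D"
  shows "1 - p * card (nonconst_monomials n (lo - 1)) - exp (- (p * card (nonconst_monomials n hi)))
    \<le> measure_pmf.prob (random_ideal n D p)
        {I :: 'k::field mpoly set. enat lo \<le> initdeg n I \<and> initdeg n I \<le> enat hi}"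
proof -
  let ?P = "\<lambda>E. measure_pmf.prob (random_ideal n D p) (E :: 'k mpoly set set)"
  let ?l = "card (nonconst_monomials n (lo - 1))" and ?h = "card (nonconst_monomials n hi)"
  let ?A = "{I :: 'k mpoly set. \<not> initdeg n I \<le> enat (lo - 1)}"
  let ?B = "{I :: 'k mpoly set. \<not> initdeg n I \<le> enat hi}"
  have "enat lo \<le> x \<longleftrightarrow> \<not> x \<le> enat (lo - 1)" for x
    using lo(1) by (cases x) auto
  then have eq: "{I :: 'k mpoly set. enat lo \<le> initdeg n I \<and> initdeg n I \<le> enat hi} = ?A - ?B"
    by auto
  have "1 - p * ?l \<le> (1 - p) ^ ?l"
    using Bernoulli_inequality[of "- p" ?l] p by (simp add: algebra_simps)
  also have "\<dots> = ?P ?A"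
    by (rule prob_random_ideal_initdeg_gt[symmetric]) (use p lo in auto)
  also have "\<dots> \<le> ?P (?A - ?B) + ?P ?B"
    using measure_pmf.finite_measure_mono[of ?A "(?A - ?B) \<union> ?B" "random_ideal n D p"]
      measure_Un_le[of "?A - ?B" "measure_pmf (random_ideal n D p)" ?B]
    by fastforce
  also have "?P ?B = (1 - p) ^ ?h"
    by (rule prob_random_ideal_initdeg_gt) (use p hi in auto)
  also have "\<dots> \<le> exp (- p) ^ ?h"
    using p exp_minus_ge[of p] by (intro power_mono) auto
  also have "\<dots> = exp (- (p * ?h))"
    by (simp add: exp_of_nat_mult[symmetric] mult.commute)
  finally show ?thesis
    unfolding eq by linarith
qed

text \<open>
  All parameters may depend on \<open>m\<close>, so that a growing number of variables and a growing degree bound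
  are covered at once.
\<close>

lemma initdeg_between_asymptotically_almost_surely:
  fixes n D lo hi :: "nat \<Rightarrow> nat" and p :: "nat \<Rightarrow> real"
  assumes bounds: "eventually (\<lambda>m. 0 \<le> p m \<and> p m \<le> 1 \<and> 1 \<le> lo m \<and> lo m \<le> D m \<and> hi m \<le> D m)
      sequentially"
    and few: "(\<lambda>m. p m * card (nonconst_monomials (n m) (lo m - 1))) \<longlonglongrightarrow> 0"
    and many: "filterlim (\<lambda>m. p m * card (nonconst_monomials (n m) (hi m))) at_top sequentially"
  shows "(\<lambda>m. measure_pmf.prob (random_ideal (n m) (D m) (p m))
      {I :: 'k::field mpoly set. enat (lo m) \<le> initdeg (n m) I \<and> initdeg (n m) I \<le> enat (hi m)})
    \<longlonglongrightarrow> 1"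
proof (rule tendsto_sandwich)
  let ?l = "\<lambda>m. p m * card (nonconst_monomials (n m) (lo m - 1))"
  let ?h = "\<lambda>m. p m * card (nonconst_monomials (n m) (hi m))"
  show "eventually (\<lambda>m. 1 - ?l m - exp (- ?h m) \<le> measure_pmf.prob (random_ideal (n m) (D m) (p m))
      {I :: 'k mpoly set. enat (lo m) \<le> initdeg (n m) I \<and> initdeg (n m) I \<le> enat (hi m)}) sequentially"
    using bounds by eventually_elim (rule prob_initdeg_between_ge; simp)
  have "(\<lambda>m. exp (- ?h m)) \<longlonglongrightarrow> 0"
    using many by (intro filterlim_compose[OF exp_at_bot])
      (simp add: filterlim_uminus_at_bot)
  then show "(\<lambda>m. 1 - ?l m - exp (- ?h m)) \<longlonglongrightarrow> 1"
    using tendsto_diff[OF tendsto_diff[OF tendsto_const few]] by fastforce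
qed auto

section \<open>Growth rates\<close>

lemma smallo_imp_mult_tendsto_0:
  fixes f g h :: "nat \<Rightarrow> real"
  assumes "f \<in> o(\<lambda>m. inverse (g m))"
    and "eventually (\<lambda>m. 0 < g m) sequentially"
    and "eventually (\<lambda>m. \<bar>h m\<bar> \<le> C * g m) sequentially"
  shows "(\<lambda>m. f m * h m) \<longlonglongrightarrow> 0"
proof (rule Lim_null_comparison)
  have "(\<lambda>m. f m / inverse (g m)) \<longlonglongrightarrow> 0"
    by (rule smalloD_tendsto[OF assms(1)])
  then have "(\<lambda>m. C * \<bar>f m * g m\<bar>) \<longlonglongrightarrow> C * 0"
    by (intro tendsto_mult_left tendsto_rabs_zero) (simp add: divide_inverse)
  then show "(\<lambda>m. C * \<bar>f m * g m\<bar>) \<longlonglongrightarrow> 0" by simp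
  show "eventually (\<lambda>m. norm (f m * h m) \<le> C * \<bar>f m * g m\<bar>) sequentially"
    using assms(2,3)
  proof eventually_elim
    case (elim m)
    have "norm (f m * h m) = \<bar>f m\<bar> * \<bar>h m\<bar>"
      by (simp add: abs_mult)
    also have "\<dots> \<le> \<bar>f m\<bar> * (C * g m)"
      by (rule mult_left_mono) (use elim in auto)
    also have "\<dots> = C * \<bar>f m * g m\<bar>"
      using elim by (simp add: abs_mult)
    finally show ?case .
  qed
qed

lemma smallomega_imp_mult_at_top:
  fixes f g h :: "nat \<Rightarrow> real"
  assumes "f \<in> \<omega>(\<lambda>m. inverse (g m))"
    and "eventually (\<lambda>m. 0 \<le> f m) sequentially"
    and "eventually (\<lambda>m. 0 < g m) sequentially"
    and "eventually (\<lambda>m. c * g m \<le> h m) sequentially" and "0 < c"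
  shows "filterlim (\<lambda>m. f m * h m) at_top sequentially"
proof (rule filterlim_at_top_mono)
  have "filterlim (\<lambda>m. norm (f m / inverse (g m))) at_top sequentially"
    by (rule smallomegaD_filterlim_at_top_norm[OF assms(1)])
      (use assms(3) in \<open>auto elim: eventually_mono\<close>)
  then show "filterlim (\<lambda>m. c * norm (f m / inverse (g m))) at_top sequentially"
    using assms(5) by (intro filterlim_tendsto_pos_mult_at_top[OF tendsto_const])
  show "eventually (\<lambda>m. c * norm (f m / inverse (g m)) \<le> f m * h m) sequentially"
    using assms(2-4)
  proof eventually_elim
    case (elim m)
    have "c * norm (f m / inverse (g m)) = f m * (c * g m)"
      using elim by (simp add: divide_inverse abs_mult)
    also have "\<dots> \<le> f m * h m"
      by (rule mult_left_mono) (use elim in auto)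
    finally show ?case .
  qed
qed

lemma initdeg_fixed_degrees:
  fixes p :: "nat \<Rightarrow> real"
  assumes d: "1 \<le> d" "d \<le> D"
    and p: "\<forall>n\<ge>1. 0 \<le> p n \<and> p n \<le> 1"
    and omega: "p \<in> \<omega>(\<lambda>n. inverse (real n ^ d))"
    and small: "p \<in> o(\<lambda>n. inverse (real n ^ (d - 1)))"
  shows "(\<lambda>n. measure_pmf.prob (random_ideal n D (p n))
           {I :: 'k::field mpoly set. initdeg n I = enat d}) \<longlonglongrightarrow> 1"
proof -
  have pos: "eventually (\<lambda>n. 0 < real n ^ k) sequentially" for k
    using eventually_gt_at_top[of 0] by eventually_elim simp
  have "(\<lambda>n. p n * card (nonconst_monomials n (d - 1))) \<longlonglongrightarrow> 0"
  proof (rule smallo_imp_mult_tendsto_0[OF small pos])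
    show "eventually (\<lambda>n. \<bar>real (card (nonconst_monomials n (d - 1)))\<bar>
        \<le> real d ^ (d - 1) * real n ^ (d - 1)) sequentially"
      using eventually_gt_at_top[of 0]
    proof eventually_elim
      case (elim n)
      then have "real (card (nonconst_monomials n (d - 1))) \<le> real ((n * d) ^ (d - 1))"
        using card_nonconst_monomials_le(1)[of n d] d(1) by (intro of_nat_mono) auto
      then show ?case by (simp add: power_mult_distrib mult.commute)
    qed
  qed
  moreover have "filterlim (\<lambda>n. p n * card (nonconst_monomials n d)) at_top sequentially"
  proof (rule smallomega_imp_mult_at_top[OF omega _ pos])
    show "eventually (\<lambda>n. 0 \<le> p n) sequentially"
      using eventually_ge_at_top[of 1] by eventually_elim (use p in auto)
    show "eventually (\<lambda>n. inverse (real d ^ d) * real n ^ d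
        \<le> real (card (nonconst_monomials n d))) sequentially"
      using eventually_gt_at_top[of 0]
      by eventually_elim
        (use card_nonconst_monomials_ge(1) d(1) in \<open>auto simp: power_divide field_simps\<close>)
    show "0 < inverse (real d ^ d)" using d(1) by simp
  qed
  moreover have "eventually (\<lambda>n. 0 \<le> p n \<and> p n \<le> 1 \<and> 1 \<le> d \<and> d \<le> D \<and> d \<le> D) sequentially"
    using eventually_ge_at_top[of 1] by eventually_elim (use p d in auto)
  ultimately have "(\<lambda>n. measure_pmf.prob (random_ideal n D (p n))
      {I :: 'k mpoly set. enat d \<le> initdeg n I \<and> initdeg n I \<le> enat d}) \<longlonglongrightarrow> 1"
    by (intro initdeg_between_asymptotically_almost_surely)
  moreover have "{I :: 'k mpoly set. enat d \<le> initdeg n I \<and> initdeg n I \<le> enat d}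
      = {I. initdeg n I = enat d}" for n
    by auto
  ultimately show ?thesis by simp
qed

lemma initdeg_fixed_variables:
  fixes p :: "nat \<Rightarrow> real" and d1 d2 :: "nat \<Rightarrow> nat"
  assumes n: "1 \<le> n"
    and d1: "\<forall>D\<ge>1. 1 \<le> d1 D \<and> d1 D \<le> D" and d2: "\<forall>D\<ge>1. 1 \<le> d2 D \<and> d2 D \<le> D"
    and p: "\<forall>D\<ge>1. 0 \<le> p D \<and> p D \<le> 1"
    and omega: "p \<in> \<omega>(\<lambda>D. inverse (real (d1 D) ^ n))"
    and small: "p \<in> o(\<lambda>D. inverse (real (d2 D) ^ n))"
  shows "(\<lambda>D. measure_pmf.prob (random_ideal n D (p D))
           {I :: 'k::field mpoly set. enat (d2 D) \<le> initdeg n I \<and> initdeg n I \<le> enat (d1 D)}) \<longlonglongrightarrow> 1"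
proof (rule initdeg_between_asymptotically_almost_surely)
  have pos: "eventually (\<lambda>D. 0 < real (f D) ^ n) sequentially"
    if "\<forall>D\<ge>1. 1 \<le> f D \<and> f D \<le> D" for f :: "nat \<Rightarrow> nat"
    using eventually_ge_at_top[of 1] by eventually_elim (use that in force)
  show "(\<lambda>D. p D * card (nonconst_monomials n (d2 D - 1))) \<longlonglongrightarrow> 0"
  proof (rule smallo_imp_mult_tendsto_0[OF small pos[OF d2]])
    show "eventually (\<lambda>D. \<bar>real (card (nonconst_monomials n (d2 D - 1)))\<bar>
        \<le> real n ^ n * real (d2 D) ^ n) sequentially"
      using eventually_ge_at_top[of 1]
    proof eventually_elim
      case (elim D)
      then have "0 < d2 D" using d2 by force
      then have "real (card (nonconst_monomials n (d2 D - 1))) \<le> real ((n * d2 D) ^ n)"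
        using card_nonconst_monomials_le(2)[of n "d2 D"] n by (intro of_nat_mono) auto
      then show ?case by (simp add: power_mult_distrib)
    qed
  qed
  show "filterlim (\<lambda>D. p D * card (nonconst_monomials n (d1 D))) at_top sequentially"
  proof (rule smallomega_imp_mult_at_top[OF omega _ pos[OF d1]])
    show "eventually (\<lambda>D. 0 \<le> p D) sequentially"
      using eventually_ge_at_top[of 1] by eventually_elim (use p in auto)
    show "eventually (\<lambda>D. inverse (real n ^ n) * real (d1 D) ^ n
        \<le> real (card (nonconst_monomials n (d1 D)))) sequentially"
      using eventually_ge_at_top[of 1]
    proof eventually_elim
      case (elim D)
      then have "0 < d1 D" using d1 by force
      then show ?case
        using card_nonconst_monomials_ge(2)[of n "d1 D"] n by (simp add: power_divide field_simps)
    qed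
    show "0 < inverse (real n ^ n)" using n by simp
  qed
  show "eventually (\<lambda>D. 0 \<le> p D \<and> p D \<le> 1 \<and> 1 \<le> d2 D \<and> d2 D \<le> D \<and> d1 D \<le> D) sequentially"
    using eventually_ge_at_top[of 1] by eventually_elim (use p d1 d2 in auto)
qed

text \<open>
  With \<open>p = (d\<^sub>1 d\<^sub>2)\<^bsup>-n/2\<^esup>\<close>, the ratios \<open>p / d\<^sub>1\<^bsup>-n\<^esup>\<close> and \<open>d\<^sub>2\<^bsup>-n\<^esup> / p\<close> are both \<open>(d\<^sub>1 / d\<^sub>2)\<^bsup>n/2\<^esup>\<close>, which
  tends to infinity.
\<close>

lemma geometric_mean_between:
  fixes d1 d2 :: "nat \<Rightarrow> real"
  assumes n: "1 \<le> n"
    and d1: "\<forall>D\<ge>1. 1 \<le> d1 D" and d2: "\<forall>D\<ge>1. 1 \<le> d2 D"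
    and omega: "d1 \<in> \<omega>(d2)"
  defines "p \<equiv> \<lambda>D. inverse (sqrt (d1 D * d2 D) ^ n)"
  shows "\<forall>D\<ge>1. 0 \<le> p D \<and> p D \<le> 1"
    and "p \<in> \<omega>(\<lambda>D. inverse (d1 D ^ n))"
    and "p \<in> o(\<lambda>D. inverse (d2 D ^ n))"
proof -
  have prod_ge: "1 \<le> d1 D * d2 D" if "1 \<le> D" for D
    using mult_mono[of 1 "d1 D" 1 "d2 D"] d1 d2 that by force
  show "\<forall>D\<ge>1. 0 \<le> p D \<and> p D \<le> 1"
    unfolding p_def using prod_ge by (force intro!: inverse_le_1_iff[THEN iffD2] one_le_power)
  let ?q = "\<lambda>D. sqrt (d1 D / d2 D) ^ n"
  have nz: "eventually (\<lambda>D. d2 D \<noteq> 0) sequentially"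
    using eventually_ge_at_top[of 1] by eventually_elim (use d2 in force)
  have "filterlim (\<lambda>D. norm (d1 D / d2 D)) at_top sequentially"
    by (rule smallomegaD_filterlim_at_top_norm[OF omega nz])
  moreover have norm_eq: "eventually (\<lambda>D. norm (d1 D / d2 D) = d1 D / d2 D) sequentially"
    using eventually_ge_at_top[of 1] by eventually_elim (use d1 d2 in force)
  ultimately have "filterlim (\<lambda>D. d1 D / d2 D) at_top sequentially"
    using filterlim_cong[OF refl refl norm_eq] by metis
  then have q: "filterlim ?q at_top sequentially"
    using n by (intro filterlim_pow_at_top filterlim_compose[OF sqrt_at_top]) auto
  have eq1: "p D / inverse (d1 D ^ n) = ?q D" and eq2: "p D / inverse (d2 D ^ n) = inverse (?q D)"
    if "1 \<le> D" for D
  proof -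
    have pos: "0 < d1 D" "0 < d2 D" using d1 d2 that by force+
    have "x / sqrt (x * y) = sqrt x / sqrt y" if "0 < x" for x y
      using real_div_sqrt[of x] that by (simp add: real_sqrt_mult flip: divide_divide_eq_left)
    from this[OF pos(1), of "d2 D"] this[OF pos(2), of "d1 D"]
    have "d1 D / sqrt (d1 D * d2 D) = sqrt (d1 D / d2 D)"
      and "d2 D / sqrt (d1 D * d2 D) = inverse (sqrt (d1 D / d2 D))"
      by (simp_all add: real_sqrt_divide mult.commute)
    moreover have "p D / inverse (d1 D ^ n) = (d1 D / sqrt (d1 D * d2 D)) ^ n"
      and "p D / inverse (d2 D ^ n) = (d2 D / sqrt (d1 D * d2 D)) ^ n"
      by (simp_all add: p_def power_divide divide_simps)
    ultimately show "p D / inverse (d1 D ^ n) = ?q D" and "p D / inverse (d2 D ^ n) = inverse (?q D)"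
      by (simp_all add: power_inverse)
  qed
  show "p \<in> \<omega>(\<lambda>D. inverse (d1 D ^ n))"
  proof (rule smallomegaI_filterlim_at_infinity)
    show "filterlim (\<lambda>D. p D / inverse (d1 D ^ n)) at_infinity sequentially"
      by (rule filterlim_mono_eventually[OF filterlim_at_top_imp_at_infinity[OF q] order_refl order_refl])
        (use eventually_ge_at_top[of 1] in eventually_elim, simp add: eq1)
  qed
  show "p \<in> o(\<lambda>D. inverse (d2 D ^ n))"
  proof (rule smalloI_tendsto)
    have "(\<lambda>D. inverse (?q D)) \<longlonglongrightarrow> 0"
      by (rule tendsto_inverse_0_at_top[OF q])
    then show "(\<lambda>D. p D / inverse (d2 D ^ n)) \<longlonglongrightarrow> 0"
      by (rule Lim_transform_eventually)
        (use eventually_ge_at_top[of 1] in eventually_elim, simp add: eq2)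
    show "eventually (\<lambda>D. inverse (d2 D ^ n) \<noteq> 0) sequentially"
      using nz by eventually_elim simp
  qed
qed

theorem corollary1p3:
  shows "(\<forall>(D::nat) (d::nat) (p::nat \<Rightarrow> real).
            D \<ge> 1 \<longrightarrow> 1 < d \<longrightarrow> d \<le> D \<longrightarrow>
            (\<forall>n\<ge>1. 0 \<le> p n \<and> p n \<le> 1) \<longrightarrow>
            p \<in> \<omega>(\<lambda>n. real n powi (- int d)) \<longrightarrow>
            p \<in> o(\<lambda>n. real n powi (- int d + 1)) \<longrightarrow>
            (\<lambda>n. measure_pmf.prob (random_ideal n D (p n))
                   {I :: 'k::field mpoly set. initdeg n I = enat d}) \<longlonglongrightarrow> 1)
       \<and> (\<forall>(n::nat) (d1::nat \<Rightarrow> nat) (d2::nat \<Rightarrow> nat).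
            n \<ge> 1 \<longrightarrow>
            (\<forall>D\<ge>1. 1 \<le> d1 D \<and> d1 D \<le> D) \<longrightarrow>
            (\<forall>D\<ge>1. 1 \<le> d2 D \<and> d2 D \<le> D) \<longrightarrow>
            filterlim d1 at_top at_top \<longrightarrow>
            filterlim d2 at_top at_top \<longrightarrow>
            (\<forall>p::nat \<Rightarrow> real.
               (\<forall>D\<ge>1. 0 \<le> p D \<and> p D \<le> 1) \<longrightarrow>
               p \<in> \<omega>(\<lambda>D. real (d1 D) powi (- int n)) \<longrightarrow>
               p \<in> o(\<lambda>D. real (d2 D) powi (- int n)) \<longrightarrow>
               (\<lambda>D. measure_pmf.prob (random_ideal n D (p D))
                      {I :: 'k mpoly set. enat (d2 D) \<le> initdeg n I \<and>
                                          initdeg n I \<le> enat (d1 D)}) \<longlonglongrightarrow> 1)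
          \<and> ((\<lambda>D. real (d1 D)) \<in> \<omega>(\<lambda>D. real (d2 D)) \<longrightarrow>
               (\<exists>p::nat \<Rightarrow> real.
                  (\<forall>D\<ge>1. 0 \<le> p D \<and> p D \<le> 1) \<and>
                  p \<in> \<omega>(\<lambda>D. real (d1 D) powi (- int n)) \<and>
                  p \<in> o(\<lambda>D. real (d2 D) powi (- int n)))))"
proof (intro conjI allI impI)
  fix D d :: nat and p :: "nat \<Rightarrow> real"
  assume "D \<ge> 1" "1 < d" "d \<le> D" "\<forall>n\<ge>1. 0 \<le> p n \<and> p n \<le> 1"
    "p \<in> \<omega>(\<lambda>n. real n powi (- int d))" "p \<in> o(\<lambda>n. real n powi (- int d + 1))"
  moreover have "- int d + 1 = - int (d - 1)"
    using \<open>1 < d\<close> by simp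
  ultimately show "(\<lambda>n. measure_pmf.prob (random_ideal n D (p n))
      {I :: 'k mpoly set. initdeg n I = enat d}) \<longlonglongrightarrow> 1"
    by (intro initdeg_fixed_degrees) (simp_all add: power_int_minus del: of_nat_diff)
next
  fix n :: nat and d1 d2 :: "nat \<Rightarrow> nat" and p :: "nat \<Rightarrow> real"
  assume "n \<ge> 1" "\<forall>D\<ge>1. 1 \<le> d1 D \<and> d1 D \<le> D" "\<forall>D\<ge>1. 1 \<le> d2 D \<and> d2 D \<le> D"
    "\<forall>D\<ge>1. 0 \<le> p D \<and> p D \<le> 1"
    "p \<in> \<omega>(\<lambda>D. real (d1 D) powi (- int n))" "p \<in> o(\<lambda>D. real (d2 D) powi (- int n))"
  then show "(\<lambda>D. measure_pmf.prob (random_ideal n D (p D))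
      {I :: 'k mpoly set. enat (d2 D) \<le> initdeg n I \<and> initdeg n I \<le> enat (d1 D)}) \<longlonglongrightarrow> 1"
    by (intro initdeg_fixed_variables) (simp_all add: power_int_minus)
next
  fix n :: nat and d1 d2 :: "nat \<Rightarrow> nat"
  assume "n \<ge> 1" and d1: "\<forall>D\<ge>1. 1 \<le> d1 D \<and> d1 D \<le> D"
    and d2: "\<forall>D\<ge>1. 1 \<le> d2 D \<and> d2 D \<le> D"
    and "(\<lambda>D. real (d1 D)) \<in> \<omega>(\<lambda>D. real (d2 D))"
  moreover have "\<forall>D\<ge>1. 1 \<le> real (d1 D)" "\<forall>D\<ge>1. 1 \<le> real (d2 D)"
    using d1 d2 by auto
  ultimately show "\<exists>p::nat \<Rightarrow> real. (\<forall>D\<ge>1. 0 \<le> p D \<and> p D \<le> 1) \<and>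
      p \<in> \<omega>(\<lambda>D. real (d1 D) powi (- int n)) \<and> p \<in> o(\<lambda>D. real (d2 D) powi (- int n))"
    using geometric_mean_between[of n "\<lambda>D. real (d1 D)" "\<lambda>D. real (d2 D)"]
    by (intro exI conjI) (simp_all add: power_int_minus)
qed

end
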